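(* Let $n,m,r\ge1$ and let $\phi:\mathbb{R}^{n\times r}\times\mathbb{R}^{m\times r}\to\mathbb{R}^{n\times m}$, $\phi(U,V)=UV^\top$. Consider $\Psi:(U,V)\mapsto U^\top U-V^\top V\in\mathbb{R}^{r\times r}$ and assume that the vertical concatenation $(U;V)\in\mathbb{R}^{(n+m)\times r}$ has full rank, denoted $\mathtt{rk}$ (so $\mathtt{rk}=\min(n+m,r)$). Then $\Psi$ gives $\mathtt{rk}\cdot(2r+1-\mathtt{rk})/2$ independent conservation laws of $\phi$: the entries $\Psi_{i,j}$ are conservation laws of $\phi$, and on some neighborhood of $(U,V)$ exactly $\mathtt{rk}(2r+1-\mathtt{rk})/2$ of them (and no more) can be selected to form an independent family.
   Context: Write $\theta=(U,V)\in\mathbb{R}^D$, $D=(n+m)r$. $W_\phi$ is the span of the gradient vector fields $\nabla\phi_{k,l}$ of the entries of $\phi$. A $\mathcal{C}^1$ function $h$ on an open set $\Omega\subseteq\mathbb{R}^D$ is a conservation law of $\phi$ on $\Omega$ if it is constant along all solutions in $\Omega$ of $\dot\theta=\chi(\theta)$, for all $\chi\in W_\phi$. A family $(h_1,\dots,h_N)$ of conservation laws on $\Omega$ is independent if $\nabla h_1(\theta),\dots,\nabla h_N(\theta)$ are linearly independent for every $\theta\in\Omega$. *)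

theory Defs
  imports "HOL-Analysis.Analysis"
begin

definition gradient :: "('a::euclidean_space \<Rightarrow> real) \<Rightarrow> 'a \<Rightarrow> 'a" where
  "gradient f x = (THE D. GDERIV f x :> D)"

text \<open>The linear span of the vector fields \<open>\<nabla>\<phi>\<^sub>k\<^sub>,\<^sub>l\<close>: the coefficients are
  constants and do not depend on the point.\<close>

definition W :: "('a::euclidean_space \<Rightarrow> real^'m^'n) \<Rightarrow> ('a \<Rightarrow> 'a) set" where
  "W \<phi> = {X. \<exists>c :: 'n \<Rightarrow> 'm \<Rightarrow> real.
            X = (\<lambda>x. \<Sum>k\<in>UNIV. \<Sum>l\<in>UNIV. c k l *\<^sub>R gradient (\<lambda>y. \<phi> y $ k $ l) x)}"

definition solution_in :: "('a::euclidean_space \<Rightarrow> 'a) \<Rightarrow> 'a set \<Rightarrow> real set \<Rightarrow> (real \<Rightarrow> 'a) \<Rightarrow> bool" where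
  "solution_in X \<Omega> T \<theta> \<longleftrightarrow> is_interval T \<and>
     (\<forall>t\<in>T. \<theta> t \<in> \<Omega> \<and> (\<theta> has_vector_derivative X (\<theta> t)) (at t within T))"

definition C1_on :: "'a::euclidean_space set \<Rightarrow> ('a \<Rightarrow> real) \<Rightarrow> bool" where
  "C1_on \<Omega> h \<longleftrightarrow> h differentiable_on \<Omega> \<and> continuous_on \<Omega> (gradient h)"

definition conservation_law ::
    "('a::euclidean_space \<Rightarrow> real^'m^'n) \<Rightarrow> 'a set \<Rightarrow> ('a \<Rightarrow> real) \<Rightarrow> bool" where
  "conservation_law \<phi> \<Omega> h \<longleftrightarrow> open \<Omega> \<and> C1_on \<Omega> h \<and>
     (\<forall>X\<in>W \<phi>. \<forall>T \<theta>. solution_in X \<Omega> T \<theta> \<longrightarrow> (\<forall>s\<in>T. \<forall>t\<in>T. h (\<theta> s) = h (\<theta> t)))"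

text \<open>Linear independence is that of an indexed family, so a repeated gradient makes the
  family dependent; \<open>independent\<close> applied to the set of gradients would not see repetitions.\<close>

definition independent_conservation_laws ::
    "('a::euclidean_space \<Rightarrow> real^'m^'n) \<Rightarrow> 'a set \<Rightarrow> 'i set \<Rightarrow> ('i \<Rightarrow> 'a \<Rightarrow> real) \<Rightarrow> bool" where
  "independent_conservation_laws \<phi> \<Omega> I h \<longleftrightarrow> finite I \<and>
     (\<forall>i\<in>I. conservation_law \<phi> \<Omega> (h i)) \<and>
     (\<forall>x\<in>\<Omega>. \<forall>c :: 'i \<Rightarrow> real. (\<Sum>i\<in>I. c i *\<^sub>R gradient (h i) x) = 0 \<longrightarrow> (\<forall>i\<in>I. c i = 0))"

definition phi :: "(real^'r^'n) \<times> (real^'r^'m) \<Rightarrow> real^'m^'n" where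
  "phi = (\<lambda>(U, V). U ** transpose V)"

definition Psi :: "(real^'r^'n) \<times> (real^'r^'m) \<Rightarrow> real^'r^'r" where
  "Psi = (\<lambda>(U, V). transpose U ** U - transpose V ** V)"

definition vconcat :: "real^'r^'n \<Rightarrow> real^'r^'m \<Rightarrow> real^'r^('n + 'm)" where
  "vconcat U V = (\<chi> k. case k of Inl i \<Rightarrow> U $ i | Inr j \<Rightarrow> V $ j)"

end

theory Submission
  imports Defs
begin

text \<open>The gradient of \<open>\<Psi>\<^sub>i\<^sub>,\<^sub>j\<close> at \<open>(U, V)\<close> is the value at \<open>(e\<^sub>i, e\<^sub>j)\<close> of a symmetric bilinear form, and
  it is orthogonal to the gradients of all entries of \<open>\<phi>\<close>, so \<open>\<Psi>\<^sub>i\<^sub>,\<^sub>j\<close> is conserved. With \<open>W = (U;V)\<close>,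
  a combination of these gradients with coefficient matrix \<open>C\<close> vanishes iff \<open>W (C + C\<^sup>T) = 0\<close>. Let \<open>J\<close>
  index a basis of the columns of \<open>W\<close>. Take one ordering of each pair of indices that meets \<open>J\<close>:
  the corresponding gradients are independent as long as the columns in \<open>J\<close> are, which is an
  open condition, and at the given point they span the gradients of all entries of \<open>\<Psi>\<close>.\<close>

section \<open>Linear independence of indexed families\<close>

definition independent_family :: "'i set \<Rightarrow> ('i \<Rightarrow> 'a::real_vector) \<Rightarrow> bool" where
  "independent_family I v \<longleftrightarrow> (\<forall>c. (\<Sum>i\<in>I. c i *\<^sub>R v i) = 0 \<longrightarrow> (\<forall>i\<in>I. c i = 0))"

lemma independent_familyD:
  "independent_family I v \<Longrightarrow> (\<Sum>i\<in>I. c i *\<^sub>R v i) = 0 \<Longrightarrow> i \<in> I \<Longrightarrow> c i = 0"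
  unfolding independent_family_def by blast

lemma independent_family_iff:
  assumes "finite I"
  shows "independent_family I v \<longleftrightarrow> inj_on v I \<and> independent (v ` I)"
proof
  assume ind: "independent_family I v"
  have inj: "inj_on v I"
  proof (rule inj_onI, rule ccontr)
    fix i j assume ij: "i \<in> I" "j \<in> I" "v i = v j" "i \<noteq> j"
    define c :: "'a \<Rightarrow> real" where "c = (\<lambda>k. if k = i then 1 else if k = j then -1 else 0)"
    have "(\<Sum>k\<in>I. c k *\<^sub>R v k) = (\<Sum>k\<in>{i,j}. c k *\<^sub>R v k)"
      using assms ij by (intro sum.mono_neutral_right) (auto simp: c_def)
    also have "\<dots> = 0"
      using ij by (simp add: c_def)
    finally have "c i = 0"
      using independent_familyD[OF ind] ij by blast
    then show False by (simp add: c_def)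
  qed
  moreover have "independent (v ` I)"
  proof (rule independent_if_scalars_zero)
    fix f x assume "(\<Sum>x\<in>v ` I. f x *\<^sub>R x) = 0" and "x \<in> v ` I"
    then show "f x = 0"
      using independent_familyD[OF ind, of "f \<circ> v"] inj by (auto simp: sum.reindex)
  qed (use assms in simp)
  ultimately show "inj_on v I \<and> independent (v ` I)" ..
next
  assume "inj_on v I \<and> independent (v ` I)"
  then have inj: "inj_on v I" and ind: "independent (v ` I)" by auto
  show "independent_family I v"
    unfolding independent_family_def
  proof (intro allI impI ballI)
    fix c i assume c: "(\<Sum>i\<in>I. c i *\<^sub>R v i) = 0" and i: "i \<in> I"
    have "(\<Sum>x\<in>v ` I. c (inv_into I v x) *\<^sub>R x) = 0"
      using c inj by (simp add: sum.reindex)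
    then have "c (inv_into I v (v i)) = 0"
      using independentD[OF ind, of "v ` I" "\<lambda>x. c (inv_into I v x)" "v i"] assms i by auto
    then show "c i = 0" using inj i by simp
  qed
qed

text \<open>The exchange bound for families. The spanning family \<open>w\<close> may repeat values,
  which only makes its image smaller than \<open>T\<close>.\<close>

lemma card_independent_family_le:
  assumes "finite I" "finite T" "independent_family I v" "\<And>i. i \<in> I \<Longrightarrow> v i \<in> span (w ` T)"
  shows "card I \<le> card T"
proof -
  have "card I = card (v ` I)" "independent (v ` I)"
    using assms by (auto simp: independent_family_iff card_image)
  moreover have "card (v ` I) \<le> card (w ` T)"
    using independent_span_bound[of "w ` T" "v ` I"] assms \<open>independent (v ` I)\<close> by auto
  ultimately show ?thesis
    using card_image_le[OF \<open>finite T\<close>, of w] by linarith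
qed

section \<open>Openness of independence\<close>

lemma continuous_on_det:
  fixes M :: "'a::topological_space \<Rightarrow> real^'n^'n"
  assumes "\<And>i j. continuous_on S (\<lambda>x. M x $ i $ j)"
  shows "continuous_on S (\<lambda>x. det (M x))"
  unfolding det_def by (intro continuous_intros assms)

text \<open>The Gram matrix of the family, padded by the identity outside \<open>J\<close>, has nonzero
  determinant exactly when the family is independent.\<close>

lemma open_independent_family:
  fixes v :: "'a::topological_space \<Rightarrow> 'i::finite \<Rightarrow> 'b::real_inner"
  assumes cont: "\<And>i. continuous_on UNIV (\<lambda>x. v x i)"
  shows "open {x. independent_family J (v x)}"
proof -
  define M :: "'a \<Rightarrow> real^'i^'i" where
    "M x = (\<chi> i j. if i \<in> J \<and> j \<in> J then v x i \<bullet> v x j else if i = j then 1 else 0)" for x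
  \<comment> \<open>The padded Gram matrix pairs \<open>v x i\<close> with the combination having
    coefficients \<open>y\<close>, and copies \<open>y\<close> outside \<open>J\<close>.\<close>
  have Mv: "(M x *v y) $ i = (if i \<in> J then v x i \<bullet> (\<Sum>j\<in>J. y $ j *\<^sub>R v x j) else y $ i)"
    for x y i
  proof (cases "i \<in> J")
    case True
    then have "(M x *v y) $ i = (\<Sum>j\<in>UNIV. if j \<in> J then (v x i \<bullet> v x j) * y $ j else 0)"
      by (auto simp: M_def matrix_vector_mult_def intro!: sum.cong)
    also have "\<dots> = (\<Sum>j\<in>J. (v x i \<bullet> v x j) * y $ j)"
      by (simp add: sum.If_cases)
    finally show ?thesis
      using True by (simp add: inner_sum_right mult.commute)
  next
    case False
    then show ?thesis
      by (simp add: M_def matrix_vector_mult_def if_distrib[of "\<lambda>a. a * _"] cong: if_cong)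
  qed
  have "independent_family J (v x) \<longleftrightarrow> det (M x) \<noteq> 0" for x
  proof -
    have "independent_family J (v x) \<longleftrightarrow> (\<forall>y. M x *v y = 0 \<longrightarrow> y = 0)"
    proof
      assume ind: "independent_family J (v x)"
      show "\<forall>y. M x *v y = 0 \<longrightarrow> y = 0"
      proof (intro allI impI)
        fix y assume 0: "M x *v y = 0"
        let ?s = "\<Sum>j\<in>J. y $ j *\<^sub>R v x j"
        have "v x i \<bullet> ?s = 0" if "i \<in> J" for i
          using Mv[of x y i] that 0 by simp
        \<comment> \<open>The combination is orthogonal to each of its terms, hence to
          itself.\<close>
        then have "?s \<bullet> ?s = 0"
          by (subst inner_sum_left) simp
        then have "y $ i = 0" if "i \<in> J" for i
          using independent_familyD[OF ind, of "($) y" i] that by simp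
        moreover have "y $ i = 0" if "i \<notin> J" for i
          using Mv[of x y i] that 0 by simp
        ultimately show "y = 0"
          by (auto simp: vec_eq_iff)
      qed
    next
      assume ker: "\<forall>y. M x *v y = 0 \<longrightarrow> y = 0"
      show "independent_family J (v x)"
        unfolding independent_family_def
      proof (intro allI impI ballI)
        fix c i assume c: "(\<Sum>i\<in>J. c i *\<^sub>R v x i) = 0" and i: "i \<in> J"
        \<comment> \<open>Extension by zero matches the identity block outside \<open>J\<close>, so
          a relation becomes a kernel vector.\<close>
        define y :: "real^'i" where "y = (\<chi> i. if i \<in> J then c i else 0)"
        have "(\<Sum>j\<in>J. y $ j *\<^sub>R v x j) = 0"
          using c by (simp add: y_def)
        then have "M x *v y = 0"
          by (auto simp: vec_eq_iff Mv) (auto simp: y_def)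
        then have "y = 0"
          using ker by blast
        then have "y $ i = 0"
          by simp
        then show "c i = 0"
          using i by (simp add: y_def)
      qed
    qed
    also have "\<dots> \<longleftrightarrow> det (M x) \<noteq> 0"
      by (metis invertible_det_nz invertible_left_inverse matrix_left_invertible_ker)
    finally show ?thesis .
  qed
  then have eq: "{x. independent_family J (v x)} = (\<lambda>x. det (M x)) -` (- {0})"
    by auto
  have "continuous_on UNIV (\<lambda>x. det (M x))"
  proof (rule continuous_on_det)
    show "continuous_on UNIV (\<lambda>x. M x $ i $ j)" for i j
      by (cases "i \<in> J \<and> j \<in> J") (auto simp: M_def intro!: continuous_intros cont)
  qed
  then show ?thesis
    unfolding eq by (intro open_vimage) auto
qed

section \<open>Counting ordered pairs\<close>

lemma card_ordered_pairs:
  fixes f :: "'a \<Rightarrow> nat"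
  assumes "finite J" "inj_on f J"
  shows "2 * card {(i, j). i \<in> J \<and> j \<in> J \<and> f i \<le> f j} = card J * (card J + 1)"
proof -
  let ?A = "{(i, j). i \<in> J \<and> j \<in> J \<and> f i \<le> f j}"
  let ?B = "prod.swap ` ?A"
  have fin: "finite ?A"
    by (rule finite_subset[of _ "J \<times> J"]) (use assms in auto)
  \<comment> \<open>The two orderings cover the square; as \<open>f\<close> is injective on
    \<open>J\<close>, they overlap only on the diagonal.\<close>
  have "?A \<union> ?B = J \<times> J"
    by (force simp: image_iff)
  moreover have "?A \<inter> ?B = (\<lambda>i. (i, i)) ` J"
    using assms(2) by (auto simp: image_iff dest: inj_onD)
  moreover have "card ?B = card ?A"
    by (rule card_image) auto
  ultimately have "card ?A + card ?A = card (J \<times> J) + card ((\<lambda>i. (i, i)) ` J)"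
    using card_Un_Int[of ?A ?B] fin by simp
  also have "card ((\<lambda>i. (i, i)) ` J) = card J"
    by (rule card_image) (auto intro: inj_onI)
  finally show ?thesis
    by (simp add: card_cartesian_product)
qed

section \<open>Gradients and conservation\<close>

lemma gradient_eq:
  assumes "(f has_derivative (\<lambda>h. h \<bullet> D)) (at x)"
  shows "gradient f x = D"
  unfolding gradient_def gderiv_def
proof (rule the_equality)
  show "(f has_derivative (\<lambda>h. h \<bullet> D)) (at x)" by fact
next
  fix E assume "(f has_derivative (\<lambda>h. h \<bullet> E)) (at x)"
  then have "(\<lambda>h. h \<bullet> E) = (\<lambda>h. h \<bullet> D)"
    using assms by (rule has_derivative_unique)
  then show "E = D"
    by (metis vector_eq_ldot)
qed

definition phi_gradient :: "'n \<Rightarrow> 'm \<Rightarrow> (real^'r^'n) \<times> (real^'r^'m) \<Rightarrow> (real^'r^'n) \<times> (real^'r^'m)" where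
  "phi_gradient k l \<theta> = ((\<chi> a. if a = k then snd \<theta> $ l else 0), (\<chi> b. if b = l then fst \<theta> $ k else 0))"

text \<open>As a matrix this is A (x y^T + y x^T). At two axis vectors it is the gradient of an
  entry of A^T A; general arguments allow kernel vectors to be inserted later.\<close>

definition symprod :: "real^'r^'n \<Rightarrow> real^'r \<Rightarrow> real^'r \<Rightarrow> real^'r^'n" where
  "symprod A x y = (\<chi> a. (A *v x) $ a *\<^sub>R y + (A *v y) $ a *\<^sub>R x)"

text \<open>The sign of the second component comes from the term - V^T V.\<close>

definition psi_gradient ::
    "(real^'r^'n) \<times> (real^'r^'m) \<Rightarrow> real^'r \<Rightarrow> real^'r \<Rightarrow> (real^'r^'n) \<times> (real^'r^'m)" where
  "psi_gradient \<theta> x y = (symprod (fst \<theta>) x y, - symprod (snd \<theta>) x y)"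

lemma inner_vec_if_row:
  fixes w :: "'a::real_inner"
  shows "h \<bullet> (\<chi> a. if a = k then w else 0) = h $ k \<bullet> w"
  by (simp add: inner_vec_def[of h] if_distrib[of "inner _"] cong: if_cong)

lemma phi_has_derivative:
  "((\<lambda>\<theta>. phi \<theta> $ k $ l) has_derivative (\<lambda>h. h \<bullet> phi_gradient k l \<theta>)) (at \<theta>)"
proof -
  \<comment> \<open>An entry of U V^T is the inner product of a row of U and a row of V, so the
    product rule gives two single-row blocks.\<close>
  have eq: "(\<lambda>\<theta>. phi \<theta> $ k $ l) = (\<lambda>\<theta>. (fst \<theta> $ k) \<bullet> (snd \<theta> $ l))"
    by (auto simp: phi_def matrix_matrix_mult_def transpose_def inner_vec_def split: prod.splits)
  show ?thesis
    unfolding eq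
    by (rule has_derivative_eq_rhs, (rule derivative_intros bounded_linear_imp_has_derivative bounded_linear_vec_nth
       bounded_linear_compose[OF bounded_linear_vec_nth] bounded_linear_fst bounded_linear_snd)+)
      (simp add: phi_gradient_def inner_prod_def inner_vec_if_row inner_commute add.commute fun_eq_iff)
qed

lemma Psi_nth:
  "Psi \<theta> $ i $ j = (\<Sum>a\<in>UNIV. fst \<theta> $ a $ i * fst \<theta> $ a $ j) - (\<Sum>b\<in>UNIV. snd \<theta> $ b $ i * snd \<theta> $ b $ j)"
  by (auto simp: Psi_def matrix_matrix_mult_def transpose_def split: prod.splits)

lemma inner_symprod_axis:
  "h \<bullet> symprod A (axis i 1) (axis j 1) = (\<Sum>a\<in>UNIV. h $ a $ i * A $ a $ j + A $ a $ i * h $ a $ j)"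
  by (auto simp: inner_vec_def[of h] symprod_def inner_add_right inner_axis matrix_vector_mult_basis column_def
       algebra_simps intro!: sum.cong)

lemma gram_has_derivative:
  fixes A :: "real^'r^'n"
  shows "((\<lambda>A::real^'r^'n. \<Sum>a\<in>UNIV. A $ a $ i * A $ a $ j) has_derivative
    (\<lambda>h. h \<bullet> symprod A (axis i 1) (axis j 1))) (at A)"
proof -
  have "bounded_linear (\<lambda>A::real^'r^'n. A $ a $ i)" for a i
    by (intro bounded_linear_compose[OF bounded_linear_vec_nth] bounded_linear_vec_nth)
  then have *: "((\<lambda>A::real^'r^'n. A $ a $ i) has_derivative (\<lambda>h. h $ a $ i)) (at A)" for a i
    by (rule bounded_linear_imp_has_derivative)
  show ?thesis
    unfolding inner_symprod_axis
    by (rule has_derivative_eq_rhs, (rule derivative_intros *)+) (simp add: algebra_simps)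
qed

lemma Psi_has_derivative:
  "((\<lambda>\<theta>. Psi \<theta> $ i $ j) has_derivative (\<lambda>h. h \<bullet> psi_gradient \<theta> (axis i 1) (axis j 1))) (at \<theta>)"
proof -
  note fst = has_derivative_compose[OF bounded_linear_imp_has_derivative[OF bounded_linear_fst] gram_has_derivative]
  note snd = has_derivative_compose[OF bounded_linear_imp_has_derivative[OF bounded_linear_snd] gram_has_derivative]
  show ?thesis
    unfolding Psi_nth
    by (rule has_derivative_eq_rhs, rule has_derivative_diff[OF fst snd])
       (simp add: psi_gradient_def inner_prod_def)
qed

lemmas gradient_phi = gradient_eq[OF phi_has_derivative]
lemmas gradient_Psi = gradient_eq[OF Psi_has_derivative]

text \<open>The U-block contributes (Ux)_k (Vy)_l + (Uy)_k (Vx)_l, and the V-block contributes the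
  same with the opposite sign.\<close>

lemma inner_gradients_eq_0: "phi_gradient k l \<theta> \<bullet> psi_gradient \<theta> x y = 0"
proof -
  have "fst \<theta> $ k \<bullet> x = (fst \<theta> *v x) $ k" "snd \<theta> $ l \<bullet> x = (snd \<theta> *v x) $ l" for x
    by (simp_all add: matrix_vector_mul_component)
  then show ?thesis
    by (simp add: phi_gradient_def psi_gradient_def symprod_def inner_prod_def inner_commute[of _ "- _"]
        inner_commute[of "vec_lambda _"] inner_vec_if_row inner_add_left inner_commute[of x] inner_commute[of y])
qed

text \<open>By the chain rule the derivative along a trajectory is the inner product of the field
  with the gradient, which vanishes by orthogonality. A time interval is convex, so the entry is
  constant on it.\<close>

lemma conservation_law_Psi:
  assumes "open \<Omega>"
  shows "conservation_law phi \<Omega> (\<lambda>\<theta>. Psi \<theta> $ i $ j)"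
  unfolding conservation_law_def C1_on_def
proof (intro conjI ballI allI impI)
  show "(\<lambda>\<theta>. Psi \<theta> $ i $ j) differentiable_on \<Omega>"
    unfolding differentiable_on_def differentiable_def
    using Psi_has_derivative has_derivative_at_withinI by blast
  show "continuous_on \<Omega> (gradient (\<lambda>\<theta>. Psi \<theta> $ i $ j))"
    unfolding gradient_Psi[abs_def] psi_gradient_def symprod_def matrix_vector_mult_basis column_def
    by (simp, intro continuous_intros)
next
  fix X T \<theta> s t
  assume X: "X \<in> W phi" and sol: "solution_in X \<Omega> T \<theta>" and st: "s \<in> T" "t \<in> T"
  obtain c where c: "X = (\<lambda>x. \<Sum>k\<in>UNIV. \<Sum>l\<in>UNIV. c k l *\<^sub>R phi_gradient k l x)"
    using X unfolding W_def gradient_phi by blast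
  have orth: "X x \<bullet> psi_gradient x u v = 0" for x u v
    by (simp add: c inner_sum_left inner_gradients_eq_0)
  have "((\<lambda>\<tau>. Psi (\<theta> \<tau>) $ i $ j) has_derivative (\<lambda>h. 0)) (at \<tau> within T)" if "\<tau> \<in> T" for \<tau>
  proof -
    have "(\<theta> has_derivative (\<lambda>h. h *\<^sub>R X (\<theta> \<tau>))) (at \<tau> within T)"
      using sol that by (simp add: solution_in_def has_vector_derivative_def)
    from has_derivative_compose[OF this Psi_has_derivative] show ?thesis
      by (simp add: orth)
  qed
  moreover have "convex T"
    using sol by (simp add: solution_in_def is_interval_convex)
  ultimately obtain d where "\<forall>\<tau>\<in>T. Psi (\<theta> \<tau>) $ i $ j = d"
    using has_derivative_zero_constant[of T "\<lambda>\<tau>. Psi (\<theta> \<tau>) $ i $ j"] by blast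
  then show "Psi (\<theta> s) $ i $ j = Psi (\<theta> t) $ i $ j"
    using st by simp
qed (fact assms)

section \<open>The symmetric bilinear gradient form\<close>

lemma linear_symprod_left: "linear (\<lambda>x. symprod A x y)"
  by (intro linearI)
    (simp_all add: symprod_def vec_eq_iff linear_add[OF matrix_vector_mul_linear]
       linear_scale[OF matrix_vector_mul_linear] algebra_simps)

lemma linear_psi_gradient_left: "linear (\<lambda>x. psi_gradient \<theta> x y)"
proof -
  have "linear (\<lambda>x. - symprod (snd \<theta>) x y)"
    by (rule linear_compose_neg[OF linear_symprod_left])
  then show ?thesis
    unfolding psi_gradient_def
    using linear_symprod_left[of "fst \<theta>" y] by (auto simp: linear_iff)
qed

lemma psi_gradient_commute: "psi_gradient \<theta> x y = psi_gradient \<theta> y x"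
  by (simp add: psi_gradient_def symprod_def add.commute)

lemma vconcat_mult_vec_nth:
  "(vconcat U V *v x) $ Inl a = (U *v x) $ a"
  "(vconcat U V *v x) $ Inr b = (V *v x) $ b"
  by (simp_all add: matrix_vector_mult_def vconcat_def)

text \<open>Each row is a combination of \<open>x\<close> and \<open>y\<close> whose coefficients
  are entries of the images of \<open>y\<close> and \<open>x\<close>. Both vectors have to lie in
  the kernel: if only \<open>x\<close> does, multiples of \<open>x\<close> remain.\<close>

lemma psi_gradient_kernel_eq_0:
  assumes "vconcat U V *v x = 0" "vconcat U V *v y = 0"
  shows "psi_gradient (U, V) x y = 0"
proof -
  have "U *v z = 0" "V *v z = 0" if "vconcat U V *v z = 0" for z
    using that unfolding vec_eq_iff by (metis vconcat_mult_vec_nth zero_index)+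
  then show ?thesis
    using assms by (simp add: psi_gradient_def symprod_def zero_prod_def vec_eq_iff)
qed

section \<open>Selected gradients: count, independence and span\<close>

definition Psi_gradients :: "(real^'r^'n) \<times> (real^'r^'m) \<Rightarrow> 'r \<times> 'r \<Rightarrow> (real^'r^'n) \<times> (real^'r^'m)" where
  "Psi_gradients \<theta> = (\<lambda>(i, j). psi_gradient \<theta> (axis i 1) (axis j 1))"

text \<open>All entries are conserved on any open set, so only the pointwise condition on the
  gradients is left.\<close>

lemma independent_conservation_laws_Psi_iff:
  fixes \<Omega> :: "((real^'r^'n) \<times> (real^'r^'m)) set"
  assumes "open \<Omega>"
  shows "independent_conservation_laws phi \<Omega> S (\<lambda>(i, j) \<theta>. Psi \<theta> $ i $ j) \<longleftrightarrow>
    (\<forall>\<theta>\<in>\<Omega>. independent_family S (Psi_gradients \<theta>))"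
proof -
  have "gradient ((\<lambda>(i, j) \<theta>. Psi \<theta> $ i $ j) p) \<theta> = Psi_gradients \<theta> p" 
    for p and \<theta> :: "(real^'r^'n) \<times> (real^'r^'m)"
    by (cases p) (simp add: Psi_gradients_def gradient_Psi)
  moreover have "conservation_law phi \<Omega> ((\<lambda>(i, j) \<theta>. Psi \<theta> $ i $ j) p)" for p
    by (cases p) (simp add: conservation_law_Psi assms)
  ultimately show ?thesis
    by (simp add: independent_conservation_laws_def independent_family_def)
qed

text \<open>Since (i, j) and (j, i) have the same gradient, one of them is kept: a pair with a
  single index in \<open>J\<close> starts with that index, and inside \<open>J\<close> the numbering
  \<open>f\<close> decides, the index type carrying no order.\<close>

definition selected_pairs :: "('r \<Rightarrow> nat) \<Rightarrow> 'r set \<Rightarrow> ('r \<times> 'r) set" where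
  "selected_pairs f J = J \<times> (- J) \<union> {(i, j). i \<in> J \<and> j \<in> J \<and> f i \<le> f j}"

text \<open>With s = |J| and r indices in all, the two disjoint pieces have s (r - s) and s (s + 1)
  / 2 elements.\<close>

lemma card_selected_pairs:
  fixes J :: "'r::finite set"
  assumes "inj f"
  shows "real (card (selected_pairs f J)) = real (card J) * (2 * real CARD('r) + 1 - real (card J)) / 2"
proof -
  let ?A = "{(i, j). i \<in> J \<and> j \<in> J \<and> f i \<le> f j}"
  have "2 * card ?A = card J * (card J + 1)"
    using assms by (intro card_ordered_pairs) (auto intro: inj_on_subset)
  then have "2 * real (card ?A) = real (card J) * (real (card J) + 1)"
    unfolding of_nat_eq_iff[where 'a = real, symmetric] by (simp add: distrib_left)
  moreover have "card (selected_pairs f J) = card (J \<times> (- J)) + card ?A"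
    unfolding selected_pairs_def by (rule card_Un_disjoint) auto
  moreover have "real CARD('r) = real (card J) + real (card (- J))"
    by (simp add: Compl_eq_Diff_UNIV card_Diff_subset of_nat_diff card_mono)
  ultimately show ?thesis
    by (simp add: card_cartesian_product field_simps)
qed

text \<open>The right-hand side is an entry of A (C + C^T), where \<open>C\<close> is
  \<open>c\<close> extended by zero off \<open>S\<close>. A relation among gradients thus becomes a
  matrix equation.\<close>

lemma sum_symprod_nth:
  fixes A :: "real^'r^'n" and S :: "('r \<times> 'r) set" and c :: "'r \<times> 'r \<Rightarrow> real"
  defines "C i j \<equiv> if (i, j) \<in> S then c (i, j) else 0"
  shows "(\<Sum>(i, j)\<in>S. c (i, j) *\<^sub>R symprod A (axis i 1) (axis j 1)) $ a $ b
    = (\<Sum>i\<in>UNIV. (C i b + C b i) * A $ a $ i)"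
proof -
  have nth: "symprod A (axis i 1) (axis j 1) $ a $ b
      = (if j = b then A $ a $ i else 0) + (if i = b then A $ a $ j else 0)" for i j
  proof -
    have "axis k (1::real) $ b = (if k = b then 1 else 0)" for k
      by (simp add: axis_def)
    then show ?thesis
      by (simp add: symprod_def matrix_vector_mult_basis column_def)
  qed
  have "(\<Sum>(i, j)\<in>S. c (i, j) *\<^sub>R symprod A (axis i 1) (axis j 1)) $ a $ b
    = (\<Sum>(i, j)\<in>S. C i j * (symprod A (axis i 1) (axis j 1) $ a $ b))"
    by (auto simp: C_def intro!: sum.cong)
  also have "\<dots> = (\<Sum>(i, j)\<in>UNIV. C i j * (symprod A (axis i 1) (axis j 1) $ a $ b))"
    by (rule sum.mono_neutral_left) (auto simp: C_def)
  also have "\<dots> = (\<Sum>i\<in>UNIV. \<Sum>j\<in>UNIV. C i j * (if j = b then A $ a $ i else 0))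
      + (\<Sum>i\<in>UNIV. \<Sum>j\<in>UNIV. C i j * (if i = b then A $ a $ j else 0))"
    unfolding nth distrib_left UNIV_Times_UNIV[symmetric] sum.cartesian_product[symmetric]
    by (simp only: sum.distrib)
  also have "(\<Sum>i\<in>UNIV. \<Sum>j\<in>UNIV. C i j * (if j = b then A $ a $ i else 0)) = (\<Sum>i\<in>UNIV. C i b * A $ a $ i)"
    by (simp add: if_distrib[of "(*) _"] cong: if_cong)
  also have "(\<Sum>i\<in>UNIV. \<Sum>j\<in>UNIV. C i j * (if i = b then A $ a $ j else 0)) = (\<Sum>i\<in>UNIV. C b i * A $ a $ i)"
    by (subst sum.swap) (simp add: if_distrib[of "(*) _"] cong: if_cong)
  finally show ?thesis
    by (simp add: distrib_right sum.distrib)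
qed

text \<open>A relation gives W M = 0 with W = (U;V) and M = C + C^T. The block of M outside
  \<open>J\<close> is zero by selection. The columns of M with index outside \<open>J\<close> vanish
  next, and symmetry then handles the remaining ones.\<close>

lemma independent_family_Psi_gradients:
  fixes U :: "real^'r^'n" and V :: "real^'r^'m"
  assumes ind: "independent_family J (\<lambda>i. column i (vconcat U V))" and "inj f"
  shows "independent_family (selected_pairs f J) (Psi_gradients (U, V))"
  unfolding independent_family_def
proof (intro allI impI)
  let ?S = "selected_pairs f J"
  fix c assume c: "(\<Sum>p\<in>?S. c p *\<^sub>R Psi_gradients (U, V) p) = 0"
  define C where "C i j = (if (i, j) \<in> ?S then c (i, j) else 0)" for i j
  define M where "M i j = C i j + C j i" for i j
  have "(\<Sum>(i, j)\<in>?S. c (i, j) *\<^sub>R symprod U (axis i 1) (axis j 1)) = 0"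
    using arg_cong[OF c, of fst] by (simp add: fst_sum Psi_gradients_def psi_gradient_def split_def)
  from arg_cong[OF this, of "\<lambda>A. A $ _ $ _"]
  have U: "(\<Sum>i\<in>UNIV. M i b * U $ a $ i) = 0" for a b
    unfolding sum_symprod_nth by (simp add: M_def C_def)
  have "(\<Sum>(i, j)\<in>?S. c (i, j) *\<^sub>R symprod V (axis i 1) (axis j 1)) = 0"
    using arg_cong[OF c, of snd] by (simp add: snd_sum Psi_gradients_def psi_gradient_def split_def sum_negf)
  from arg_cong[OF this, of "\<lambda>A. A $ _ $ _"]
  have V: "(\<Sum>i\<in>UNIV. M i b * V $ a $ i) = 0" for a b
    unfolding sum_symprod_nth by (simp add: M_def C_def)
  have sum0: "(\<Sum>i\<in>UNIV. M i b *\<^sub>R column i (vconcat U V)) = 0" for b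
    unfolding vec_eq_iff
  proof
    fix k
    show "(\<Sum>i\<in>UNIV. M i b *\<^sub>R column i (vconcat U V)) $ k = 0 $ k"
      by (cases k) (simp_all add: column_def vconcat_def U V)
  qed
  \<comment> \<open>A column of \<open>M\<close> supported on \<open>J\<close> is a relation among
    the independent columns of (U;V).\<close>
  have M0: "M i b = 0" if "i \<in> J" and off: "\<And>i. i \<notin> J \<Longrightarrow> M i b = 0" for i b
  proof (rule independent_familyD[OF ind, of "\<lambda>i. M i b"])
    have "(\<Sum>i\<in>J. M i b *\<^sub>R column i (vconcat U V)) = (\<Sum>i\<in>UNIV. M i b *\<^sub>R column i (vconcat U V))"
      by (rule sum.mono_neutral_left) (auto simp: off)
    then show "(\<Sum>i\<in>J. M i b *\<^sub>R column i (vconcat U V)) = 0"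
      using sum0 by simp
  qed fact
  have sym: "M i j = M j i" for i j
    by (simp add: M_def add.commute)
  have outside: "M i b = 0" if "i \<notin> J" "b \<notin> J" for i b
    using that by (simp add: M_def C_def selected_pairs_def)
  have mixed: "M i b = 0" if "i \<in> J" "b \<notin> J" for i b
    using M0[OF \<open>i \<in> J\<close>] outside \<open>b \<notin> J\<close> by blast
  \<comment> \<open>By symmetry, \<open>mixed\<close> says that column \<open>b\<close> is zero off
    \<open>J\<close>, so \<open>M0\<close> applies again.\<close>
  have inside: "M i b = 0" if "i \<in> J" "b \<in> J" for i b
    using M0[OF \<open>i \<in> J\<close>] mixed[OF \<open>b \<in> J\<close>] sym by metis
  show "\<forall>p\<in>?S. c p = 0"
  proof
    fix p assume p: "p \<in> ?S"
    obtain i j where ij: "p = (i, j)" by (cases p)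
    have "M i j = 0"
      using inside mixed p ij by (auto simp: selected_pairs_def)
    \<comment> \<open>Only one ordering is selected, so \<open>M i j\<close> is the coefficient
      itself off the diagonal and twice it on the diagonal.\<close>
    moreover have "(j, i) \<in> ?S \<Longrightarrow> i = j"
      using p ij \<open>inj f\<close> by (auto simp: selected_pairs_def dest: injD)
    ultimately show "c p = 0"
      using p by (auto simp: M_def C_def ij split: if_splits)
  qed
qed

text \<open>If \<open>e\<^sub>k - p\<close> and \<open>e\<^sub>l - q\<close> lie in the kernel of \<open>(U;V)\<close>, with \<open>p\<close> and \<open>q\<close> supported on \<open>J\<close>,
  then the gradient form vanishes on this pair, so its value on \<open>(e\<^sub>k, e\<^sub>l)\<close> is a combination of
  values with one argument supported on \<open>J\<close>.\<close>

lemma Psi_gradients_in_span: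
  fixes U :: "real^'r^'n" and V :: "real^'r^'m" and f :: "'r \<Rightarrow> nat"
  assumes cols: "\<And>k. column k (vconcat U V) \<in> span ((\<lambda>i. column i (vconcat U V)) ` J)"
  shows "Psi_gradients (U, V) q \<in> span (Psi_gradients (U, V) ` selected_pairs f J)"
proof -
  let ?W = "vconcat U V" and ?g = "psi_gradient (U, V)"
  let ?Sp = "span (Psi_gradients (U, V) ` selected_pairs f J)"
  let ?E = "span ((\<lambda>a. axis a 1) ` J) :: (real^'r) set"
  note lin = linear_psi_gradient_left[of "(U, V)"]
  \<comment> \<open>One of the two orderings is selected as soon as \<open>a\<close> is in
    \<open>J\<close>, and both have the same gradient.\<close>
  have axes: "?g (axis a 1) (axis j 1) \<in> ?Sp" if "a \<in> J" for a j
  proof (cases "(a, j) \<in> selected_pairs f J")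
    case True
    then show ?thesis
      by (intro span_base) (force simp: Psi_gradients_def)
  next
    case False
    then have "(j, a) \<in> selected_pairs f J"
      using that by (auto simp: selected_pairs_def)
    then show ?thesis
      by (intro span_base) (force simp: Psi_gradients_def intro: psi_gradient_commute)
  qed
  \<comment> \<open>The free argument is expanded in axis vectors; symmetry moves it to the left,
    where linearity is available.\<close>
  have axis_left: "?g (axis a 1) y \<in> ?Sp" if "a \<in> J" for a y
  proof -
    have "(\<Sum>j\<in>UNIV. y $ j *\<^sub>R axis j 1) = y"
      using basis_expansion[of y] by (simp add: scalar_mult_eq_scaleR)
    then have "?g y (axis a 1) = ?g (\<Sum>j\<in>UNIV. y $ j *\<^sub>R axis j 1) (axis a 1)"
      by (rule arg_cong[OF sym])
    also have "\<dots> = (\<Sum>j\<in>UNIV. y $ j *\<^sub>R ?g (axis j 1) (axis a 1))"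
      by (simp only: linear_sum[OF lin] linear_scale[OF lin])
    also have "\<dots> \<in> ?Sp"
      unfolding psi_gradient_commute[of _ _ "axis a 1"] by (intro span_sum span_scale axes that)
    finally show ?thesis
      by (subst psi_gradient_commute)
  qed
  have left: "?g p y \<in> ?Sp" if "p \<in> ?E" for p y
  proof -
    have "?g p y \<in> span ((\<lambda>x. ?g x y) ` (\<lambda>a. axis a 1) ` J)"
      using that by (simp add: linear_span_image[OF lin])
    also have "\<dots> \<subseteq> ?Sp"
      using axis_left by (intro span_minimal) auto
    finally show ?thesis .
  qed
  \<comment> \<open>Column k is the image of the k-th axis vector, so writing it through the columns
    in \<open>J\<close> yields a preimage \<open>p\<close> supported on \<open>J\<close>.\<close>
  have approx: "\<exists>p\<in>?E. ?W *v (axis k 1 - p) = 0" for k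
  proof -
    have "column k ?W \<in> (*v) ?W ` ?E"
      using cols[of k]
      by (simp add: linear_span_image[OF matrix_vector_mul_linear, symmetric] image_image matrix_vector_mult_basis)
    then show ?thesis
      by (auto simp: matrix_vector_mult_diff_distrib matrix_vector_mult_basis)
  qed
  obtain k l where q: "q = (k, l)" by (cases q)
  obtain p where p: "p \<in> ?E" "?W *v (axis k 1 - p) = 0" using approx by blast
  obtain p' where p': "p' \<in> ?E" "?W *v (axis l 1 - p') = 0" using approx by blast
  have diff: "?g (x - x') y = ?g x y - ?g x' y" for x x' y
    by (rule linear_diff[OF lin])
  have diff': "?g y (x - x') = ?g y x - ?g y x'" for x x' y
    unfolding psi_gradient_commute[of _ y] by (rule diff)
  \<comment> \<open>In the bilinear expansion every term except the wanted one has an argument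
    supported on \<open>J\<close>.\<close>
  have "0 = ?g (axis k 1 - p) (axis l 1 - p')"
    using psi_gradient_kernel_eq_0[OF p(2) p'(2)] by simp
  also have "\<dots> = ?g (axis k 1) (axis l 1) - ?g p (axis l 1) - (?g (axis k 1) p' - ?g p p')"
    by (simp only: diff diff')
  also have "?g (axis k 1) p' = ?g p' (axis k 1)"
    by (rule psi_gradient_commute)
  finally have "?g (axis k 1) (axis l 1) = ?g p' (axis k 1) + (?g p (axis l 1) - ?g p p')"
    by (simp add: algebra_simps)
  also have "\<dots> \<in> ?Sp"
    by (intro span_add span_diff left p p')
  finally show ?thesis
    by (simp add: q Psi_gradients_def)
qed

section \<open>A column basis and the neighborhood\<close>

lemma basis_columns:
  fixes A :: "real^'r^'n"
  obtains J where "card J = rank A" "independent_family J (\<lambda>i. column i A)"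
    "\<And>k. column k A \<in> span ((\<lambda>i. column i A) ` J)"
proof -
  obtain B where B: "B \<subseteq> columns A" "independent B" "columns A \<subseteq> span B"
    using maximal_independent_subset by blast
  have "columns A = range (\<lambda>i. column i A)"
    by (auto simp: columns_def)
  \<comment> \<open>One index per basis vector is chosen, so equal columns are not counted twice and
    |J| is the rank.\<close>
  then obtain J where J: "inj_on (\<lambda>i. column i A) J" "B = (\<lambda>i. column i A) ` J"
    using B(1) subset_image_inj[of B "\<lambda>i. column i A" UNIV] by auto
  have "card J = rank A"
    using J B basis_card_eq_dim[of B "columns A"] by (simp add: card_image column_rank_def)
  moreover have "independent_family J (\<lambda>i. column i A)"
    using J B by (subst independent_family_iff) (auto intro: finite_subset)
  moreover have "column k A \<in> span ((\<lambda>i. column i A) ` J)" for k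
    using J B by (auto simp: columns_def)
  ultimately show thesis
    using that by blast
qed

lemma continuous_on_column_vconcat:
  "continuous_on S (\<lambda>\<theta> :: (real^'r^'n) \<times> (real^'r^'m). column i (vconcat (fst \<theta>) (snd \<theta>)))"
  unfolding column_def vconcat_def
proof (intro continuous_on_vec_lambda)
  show "continuous_on S (\<lambda>\<theta>. (\<chi> k. case k of Inl a \<Rightarrow> fst \<theta> $ a | Inr b \<Rightarrow> snd \<theta> $ b) $ k $ i)"
    for k and S :: "((real^'r^'n) \<times> (real^'r^'m)) set"
    by (cases k) (auto intro!: continuous_intros)
qed

theorem proposition4p2:
  fixes U :: "real^'r^'n" and V :: "real^'r^'m" and rk :: nat
  assumes rk: "rk = rank (vconcat U V)"
    and full_rank: "rk = min (CARD('n) + CARD('m)) CARD('r)"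
  shows "(\<forall>i j. conservation_law (phi :: (real^'r^'n) \<times> (real^'r^'m) \<Rightarrow> real^'m^'n) UNIV
                  (\<lambda>\<theta>. Psi \<theta> $ i $ j)) \<and>
    (\<exists>\<Omega>. open \<Omega> \<and> (U, V) \<in> \<Omega> \<and>
      (\<exists>S :: ('r \<times> 'r) set.
         independent_conservation_laws phi \<Omega> S (\<lambda>(i, j) \<theta>. Psi \<theta> $ i $ j) \<and>
         real (card S) = real rk * (2 * real CARD('r) + 1 - real rk) / 2) \<and>
      (\<forall>\<Omega>' \<subseteq> \<Omega>. \<forall>S :: ('r \<times> 'r) set.
         open \<Omega>' \<and> (U, V) \<in> \<Omega>' \<and>
         independent_conservation_laws phi \<Omega>' S (\<lambda>(i, j) \<theta>. Psi \<theta> $ i $ j) \<longrightarrow>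
         real (card S) \<le> real rk * (2 * real CARD('r) + 1 - real rk) / 2))"
proof -
  let ?W = "vconcat U V" and ?N = "real rk * (2 * real CARD('r) + 1 - real rk) / 2"
  obtain J where J: "card J = rk" "independent_family J (\<lambda>i. column i ?W)"
      "\<And>k. column k ?W \<in> span ((\<lambda>i. column i ?W) ` J)"
    using basis_columns[of ?W] rk by metis
  \<comment> \<open>Any injective numbering of the indices can serve as the tie-break.\<close>
  obtain f :: "'r \<Rightarrow> nat" where f: "inj f"
    using finite_imp_inj_to_nat_seg[of "UNIV :: 'r set"] by auto
  let ?S = "selected_pairs f J"
  \<comment> \<open>The index set \<open>J\<close> is fixed at (U, V); the neighborhood consists of
    the points where the columns it selects stay independent.\<close>
  define \<Omega> :: "((real^'r^'n) \<times> (real^'r^'m)) set"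
    where "\<Omega> = {\<theta>. independent_family J (\<lambda>i. column i (vconcat (fst \<theta>) (snd \<theta>)))}"
  have "open \<Omega>"
    unfolding \<Omega>_def by (intro open_independent_family continuous_on_column_vconcat)
  have "(U, V) \<in> \<Omega>"
    using J(2) by (simp add: \<Omega>_def)
  have card: "real (card ?S) = ?N"
    using card_selected_pairs[OF f] J(1) by simp
  have "independent_conservation_laws phi \<Omega> ?S (\<lambda>(i, j) \<theta>. Psi \<theta> $ i $ j)"
    using independent_family_Psi_gradients[OF _ f] \<open>open \<Omega>\<close>
    by (auto simp: independent_conservation_laws_Psi_iff \<Omega>_def)
  \<comment> \<open>Independence is evaluated at (U, V), where the selected gradients span those of
    all entries; the exchange bound gives maximality.\<close>
  moreover have "real (card S) \<le> ?N"
    if "open \<Omega>'" "(U, V) \<in> \<Omega>'" "independent_conservation_laws phi \<Omega>' S (\<lambda>(i, j) \<theta>. Psi \<theta> $ i $ j)"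
    for \<Omega>' S
  proof -
    have "independent_family S (Psi_gradients (U, V))"
      using that by (simp add: independent_conservation_laws_Psi_iff)
    then have "card S \<le> card ?S"
      using Psi_gradients_in_span[OF J(3)] by (intro card_independent_family_le) auto
    then show ?thesis
      unfolding card[symmetric] by simp
  qed
  ultimately show ?thesis
    using card \<open>open \<Omega>\<close> \<open>(U, V) \<in> \<Omega>\<close> conservation_law_Psi[OF open_UNIV] by blast
qed

end
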